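(* Let $X$ and $Y$ be real-valued random variables on a common probability space $(\Omega,\Sigma,\mathbb{P})$ such that both supports $\operatorname{supp}(\mathbb{P}_X)$ and $\operatorname{supp}(\mathbb{P}_Y)$ are arbitrary intervals (bounded or unbounded), and such that $$\operatorname{supp}(\mathbb{P}_{(X,Y)})=\operatorname{supp}(\mathbb{P}_X)\times\operatorname{supp}(\mathbb{P}_Y).$$ Then $X$ and $Y$ are independent if and only if they are locally uncorrelated.
   Context: $\mathbb{P}_Z$ denotes the distribution of a random variable or vector $Z$. The support $\operatorname{supp}(P)$ of a Borel probability measure $P$ on $\mathbb{R}^n$ is the smallest closed set $D$ with $P(D)=1$. For an event $U$ with $\mathbb{P}[U]>0$, $E[Z|U]=E[Z1_U]/\mathbb{P}[U]$ and $\operatorname{cov}_U(X,Y)=E[XY|U]-E[X|U]\cdot E[Y|U]$. The random variables $X$ and $Y$ are called locally uncorrelated if there is $\varepsilon>0$ such that $\operatorname{cov}_U(X,Y)=0$ for any event $U=\{X\in[a,b],\ Y\in[c,d]\}$ (with $a<b$, $c<d$) satisfying $\mathbb{P}[U]>0$ and $\max(b-a,d-c)\le\varepsilon$. *)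

theory Defs
  imports "HOL-Probability.Probability"
begin

text \<open>For a Borel probability measure on a second-countable space the intersection below
  is itself a closed set of full measure, hence the smallest one (see \<open>is_least_measure_support\<close>).\<close>

definition measure_support :: "'a::topological_space measure \<Rightarrow> 'a set" where
  "measure_support P = \<Inter> {D. closed D \<and> emeasure P D = 1}"

lemma is_least_measure_support:
  fixes P :: "'a::second_countable_topology measure"
  assumes "prob_space P" and sets: "sets P = sets borel"
  shows "closed (measure_support P)" and "emeasure P (measure_support P) = 1"
    and "\<And>D. closed D \<Longrightarrow> emeasure P D = 1 \<Longrightarrow> measure_support P \<subseteq> D"
proof -
  interpret prob_space P by fact
  define F where "F = {D :: 'a set. closed D \<and> emeasure P D = 1}"
  show "closed (measure_support P)"
    unfolding measure_support_def by auto
  show "\<And>D. closed D \<Longrightarrow> emeasure P D = 1 \<Longrightarrow> measure_support P \<subseteq> D"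
    unfolding measure_support_def by auto
  have "\<And>S. S \<in> uminus ` F \<Longrightarrow> open S"
    by (auto simp: F_def)
  then obtain G where G: "G \<subseteq> uminus ` F" "countable G" "\<Union> G = \<Union> (uminus ` F)"
    using Lindelof by metis
  have "AE x in P. x \<in> - S" if "S \<in> G" for S
  proof -
    from that G obtain D where "closed D" "emeasure P D = 1" and S: "S = - D"
      by (auto simp: F_def)
    then have "prob D = 1"
      by (simp add: measure_def)
    moreover have "D \<in> sets P"
      using \<open>closed D\<close> sets by auto
    ultimately show ?thesis
      by (simp add: S prob_eq_1)
  qed
  then have "AE x in P. \<forall>S\<in>G. x \<in> - S"
    using G by (simp add: AE_ball_countable)
  moreover have "(\<forall>S\<in>G. x \<in> - S) \<longleftrightarrow> x \<in> measure_support P" for x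
  proof -
    have "(\<forall>S\<in>G. x \<in> - S) \<longleftrightarrow> x \<notin> \<Union> G" by auto
    also have "\<dots> \<longleftrightarrow> x \<notin> \<Union> (uminus ` F)" using G by simp
    also have "\<dots> \<longleftrightarrow> x \<in> measure_support P" by (auto simp: F_def measure_support_def)
    finally show ?thesis .
  qed
  ultimately have "AE x in P. x \<in> measure_support P"
    by simp
  moreover have "measure_support P \<in> sets P"
    using \<open>closed (measure_support P)\<close> sets by auto
  ultimately show "emeasure P (measure_support P) = 1"
    by (simp add: emeasure_eq_measure prob_eq_1)
qed

definition event_expectation :: "'a measure \<Rightarrow> 'a set \<Rightarrow> ('a \<Rightarrow> real) \<Rightarrow> real" where
  "event_expectation M U Z = (\<integral>\<omega>. Z \<omega> * indicator U \<omega> \<partial>M) / measure M U"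

definition event_cov :: "'a measure \<Rightarrow> 'a set \<Rightarrow> ('a \<Rightarrow> real) \<Rightarrow> ('a \<Rightarrow> real) \<Rightarrow> real" where
  "event_cov M U X Y =
     event_expectation M U (\<lambda>\<omega>. X \<omega> * Y \<omega>) - event_expectation M U X * event_expectation M U Y"

definition locally_uncorrelated :: "'a measure \<Rightarrow> ('a \<Rightarrow> real) \<Rightarrow> ('a \<Rightarrow> real) \<Rightarrow> bool" where
  "locally_uncorrelated M X Y \<longleftrightarrow>
     (\<exists>\<epsilon>>0. \<forall>a b c d. a < b \<longrightarrow> c < d \<longrightarrow> max (b - a) (d - c) \<le> \<epsilon> \<longrightarrow>
        (let U = {\<omega> \<in> space M. X \<omega> \<in> {a..b} \<and> Y \<omega> \<in> {c..d}}
         in measure M U > 0 \<longrightarrow> event_cov M U X Y = 0))"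

end

theory Submission
  imports Defs
begin

text \<open>
  Independence makes truncations of \<open>X\<close> and \<open>Y\<close> to intervals independent, hence uncorrelated on every
  rectangle (\<open>locally_uncorrelated_if_indep\<close>). The content is the converse.

  \<^emph>\<open>Local step.\<close> The key is a fact about finite measures on the line (\<open>proportional_measures\<close>): if
  \<open>\<alpha>\<close> and \<open>\<beta>\<close> have the same barycentre on every interval, then they are proportional. Indeed the
  assumption says that \<open>t - s\<close> integrates to zero over each square \<open>[a, b]\<^sup>2\<close> against \<open>\<alpha> \<otimes> \<beta>\<close>. Folding
  the square along the diagonal, the measures \<open>(t - s) (\<alpha> \<otimes> \<beta>)\<close> and \<open>(t - s) (\<beta> \<otimes> \<alpha>)\<close> on \<open>{s < t}\<close> agree on
  a generator stable under intersection, so they are equal, and \<open>\<alpha> \<otimes> \<beta>\<close> is symmetric.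
  Vanishing covariance on \<open>[a, b] \<times> J\<close> for all small \<open>[a, b]\<close> is the hypothesis of this fact for the law
  of \<open>X\<close> on the strip \<open>Y \<in> J\<close> and the same law weighted by \<open>Y\<close>. So the conditional mean of
  \<open>Y\<close> given \<open>Y \<in> J\<close> and \<open>X \<in> B\<close> does not depend on \<open>B\<close> (\<open>conditional_mean_constant\<close>). As this holds for
  every small interval \<open>J\<close>, the fact applies once more, to the laws of \<open>Y\<close> given \<open>X \<in> B\<close> for different \<open>B\<close>,
  and shows that they are proportional: \<open>X\<close> and \<open>Y\<close> are conditionally independent on every
  small rectangle (\<open>factorizes_on_if_uncorrelated\<close>).

  \<^emph>\<open>Global step.\<close> Conditional independence on two rectangles over the same interval of \<open>Y\<close> extends to their union
  when their overlap has positive probability (\<open>factorizes_on_Un\<close>). Because the joint support is the product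
  of two intervals, an overlap in a growing chain of rectangles can be null only when the chain has
  already exhausted the support on that side, so independence spreads first along \<open>X\<close> and then along \<open>Y\<close> to the whole plane
  (\<open>factorizes_on_UNIV_if_locally\<close>).
\<close>

section \<open>Measures with the same barycentre on every interval\<close>

text \<open>The hypothesis says that \<open>\<integral>\<integral> (t - s)\<close> over the square \<open>[a, b]\<^sup>2\<close> with respect to \<open>\<alpha> \<otimes> \<beta>\<close> vanishes.
  So its part above the diagonal equals the negative of its part below, and reflecting the latter in the
  diagonal turns it into the part above the diagonal for \<open>\<beta> \<otimes> \<alpha>\<close>. A pair \<open>s < t\<close> lies in the square
  exactly when \<open>a \<le> s\<close> and \<open>t \<le> b\<close>, which is why the quadrant \<open>{a..} \<times> {..b}\<close> can replace it: conversion of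
  a real to an extended nonnegative real sends the negative values of \<open>t - s\<close> to \<open>0\<close>.\<close>

lemma nn_integral_antisymmetric_part:
  fixes \<alpha> \<beta> :: "real measure"
  assumes fin: "finite_measure \<alpha>" "finite_measure \<beta>"
    and [measurable_cong, simp]: "sets \<alpha> = sets borel" "sets \<beta> = sets borel"
    and eq: "(\<integral>x. x * indicator {a..b} x \<partial>\<alpha>) * measure \<beta> {a..b} =
             (\<integral>x. x * indicator {a..b} x \<partial>\<beta>) * measure \<alpha> {a..b}"
  shows "(\<integral>\<^sup>+ z. ennreal (snd z - fst z) * indicator ({a..} \<times> {..b}) z \<partial>(\<alpha> \<Otimes>\<^sub>M \<beta>)) =
         (\<integral>\<^sup>+ z. ennreal (snd z - fst z) * indicator ({a..} \<times> {..b}) z \<partial>(\<beta> \<Otimes>\<^sub>M \<alpha>))"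
    and "(\<integral>\<^sup>+ z. ennreal (snd z - fst z) * indicator ({a..} \<times> {..b}) z \<partial>(\<alpha> \<Otimes>\<^sub>M \<beta>)) \<noteq> \<infinity>"
proof -
  interpret \<alpha>: finite_measure \<alpha> by fact
  interpret \<beta>: finite_measure \<beta> by fact
  interpret P: pair_sigma_finite \<alpha> \<beta> ..
  interpret P': finite_measure "\<alpha> \<Otimes>\<^sub>M \<beta>"
    by (intro finite_measure_pair_measure fin)
  have [simp]: "space \<alpha> = UNIV" "space \<beta> = UNIV"
    using sets_eq_imp_space_eq[of \<alpha> borel] sets_eq_imp_space_eq[of \<beta> borel] by auto
  define g :: "real \<times> real \<Rightarrow> real" where
    "g z = (snd z - fst z) * (indicator {a..b} (fst z) * indicator {a..b} (snd z))" for z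
  have g_meas [measurable]: "g \<in> borel_measurable (borel \<Otimes>\<^sub>M borel)"
    unfolding g_def[abs_def] by measurable
  have f_eq: "ennreal (snd z - fst z) * indicator ({a..} \<times> {..b}) z = ennreal (g z)" for z
    by (cases z) (auto simp: g_def indicator_def ennreal_neg)
  have bnd: "\<bar>x * indicator {a..b} x\<bar> \<le> \<bar>a\<bar> + \<bar>b\<bar>" for x :: real
    by (auto simp: indicator_def)
  have int: "integrable \<alpha> (\<lambda>x. x * indicator {a..b} x)" "integrable \<beta> (\<lambda>x. x * indicator {a..b} x)"
    using bnd by (auto intro!: \<alpha>.integrable_const_bound[where B="\<bar>a\<bar> + \<bar>b\<bar>"]
        \<beta>.integrable_const_bound[where B="\<bar>a\<bar> + \<bar>b\<bar>"])
  have int': "integrable \<alpha> (\<lambda>x. indicator {a..b} x :: real)" "integrable \<beta> (\<lambda>x. indicator {a..b} x :: real)"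
    by (auto intro!: integrable_real_indicator simp: less_top[symmetric])
  have g_int: "integrable (\<alpha> \<Otimes>\<^sub>M \<beta>) g"
  proof (rule P'.integrable_const_bound[where B="\<bar>a\<bar> + \<bar>b\<bar> + (\<bar>a\<bar> + \<bar>b\<bar>)"])
    show "AE z in \<alpha> \<Otimes>\<^sub>M \<beta>. norm (g z) \<le> \<bar>a\<bar> + \<bar>b\<bar> + (\<bar>a\<bar> + \<bar>b\<bar>)"
      by (rule AE_I2) (auto simp: g_def indicator_def)
  qed measurable
  have "integral\<^sup>L (\<alpha> \<Otimes>\<^sub>M \<beta>) g = (\<integral>s. \<integral>t. g (s, t) \<partial>\<beta> \<partial>\<alpha>)"
    by (rule P.integral_fst'[symmetric]) (rule g_int)
  also have "\<dots> = (\<integral>s. indicator {a..b} s * (\<integral>t. t * indicator {a..b} t \<partial>\<beta>)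
                     - s * indicator {a..b} s * measure \<beta> {a..b} \<partial>\<alpha>)"
  proof (rule Bochner_Integration.integral_cong[OF refl])
    fix s
    have "(\<integral>t. g (s, t) \<partial>\<beta>) = (\<integral>t. indicator {a..b} s * (t * indicator {a..b} t)
            - s * indicator {a..b} s * indicator {a..b} t \<partial>\<beta>)"
      by (rule Bochner_Integration.integral_cong) (auto simp: g_def algebra_simps)
    also have "\<dots> = indicator {a..b} s * (\<integral>t. t * indicator {a..b} t \<partial>\<beta>)
                     - s * indicator {a..b} s * measure \<beta> {a..b}"
      using int int' by (subst Bochner_Integration.integral_diff) auto
    finally show "(\<integral>t. g (s, t) \<partial>\<beta>) = \<dots>" .
  qed
  also have "\<dots> = measure \<alpha> {a..b} * (\<integral>t. t * indicator {a..b} t \<partial>\<beta>)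
                     - (\<integral>x. x * indicator {a..b} x \<partial>\<alpha>) * measure \<beta> {a..b}"
    using int int' by (subst Bochner_Integration.integral_diff) auto
  finally have "integral\<^sup>L (\<alpha> \<Otimes>\<^sub>M \<beta>) g = 0"
    using eq by (simp add: mult.commute)
  moreover have fin_pos: "(\<integral>\<^sup>+ z. ennreal (g z) \<partial>(\<alpha> \<Otimes>\<^sub>M \<beta>)) \<noteq> \<infinity>" "(\<integral>\<^sup>+ z. ennreal (- g z) \<partial>(\<alpha> \<Otimes>\<^sub>M \<beta>)) \<noteq> \<infinity>"
    using g_int by (auto simp: real_integrable_def)
  ultimately have "(\<integral>\<^sup>+ z. ennreal (g z) \<partial>(\<alpha> \<Otimes>\<^sub>M \<beta>)) = (\<integral>\<^sup>+ z. ennreal (- g z) \<partial>(\<alpha> \<Otimes>\<^sub>M \<beta>))"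
    using real_lebesgue_integral_def[OF g_int]
    by (metis ennreal_enn2real eq_iff_diff_eq_0 infinity_ennreal_def less_top)
  also have "\<dots> = (\<integral>\<^sup>+ z. ennreal (- g z) \<partial>distr (\<beta> \<Otimes>\<^sub>M \<alpha>) (\<alpha> \<Otimes>\<^sub>M \<beta>) (\<lambda>(x, y). (y, x)))"
    by (subst P.distr_pair_swap) simp
  also have "\<dots> = (\<integral>\<^sup>+ z. ennreal (g z) \<partial>(\<beta> \<Otimes>\<^sub>M \<alpha>))"
    by (subst nn_integral_distr) (auto intro!: nn_integral_cong arg_cong[where f=ennreal] simp: g_def algebra_simps)
  finally show "(\<integral>\<^sup>+ z. ennreal (snd z - fst z) * indicator ({a..} \<times> {..b}) z \<partial>(\<alpha> \<Otimes>\<^sub>M \<beta>)) =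
         (\<integral>\<^sup>+ z. ennreal (snd z - fst z) * indicator ({a..} \<times> {..b}) z \<partial>(\<beta> \<Otimes>\<^sub>M \<alpha>))"
    unfolding f_eq .
  show "(\<integral>\<^sup>+ z. ennreal (snd z - fst z) * indicator ({a..} \<times> {..b}) z \<partial>(\<alpha> \<Otimes>\<^sub>M \<beta>)) \<noteq> \<infinity>"
    using fin_pos unfolding f_eq by simp
qed

text \<open>The quadrants are stable under intersection and generate the plane Borel sets, so agreement on them
  suffices to identify two measures. The squares themselves would only generate sets symmetric about
  the diagonal.\<close>

lemma sets_pair_half_lines:
  "sets (borel \<Otimes>\<^sub>M borel :: (real \<times> real) measure) =
     sigma_sets UNIV {{a..} \<times> {..b} | a b. True}"
proof -
  have "sets (borel \<Otimes>\<^sub>M borel :: (real \<times> real) measure)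
      = sets (sigma (space borel \<times> space borel)
          {A \<times> B | A B. A \<in> range (\<lambda>x::real. {x..}) \<and> B \<in> range (\<lambda>x::real. {..x})})"
  proof (rule sets_pair_eq)
    show "sets (borel :: real measure) = sigma_sets (space borel) (range (\<lambda>x. {x..}))"
      by (subst borel_Ici) simp
    show "sets (borel :: real measure) = sigma_sets (space borel) (range (\<lambda>x. {..x}))"
      by (subst borel_eq_atMost) simp
    show "\<Union> ((\<lambda>n. {- real n..}) ` UNIV) = space borel"
      by auto (metis minus_le_iff real_arch_simple)
    show "\<Union> ((\<lambda>n. {..real n}) ` UNIV) = space borel"
      using real_arch_simple by auto
  qed auto
  also have "{A \<times> B | A B. A \<in> range (\<lambda>x::real. {x..}) \<and> B \<in> range (\<lambda>x::real. {..x})}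
      = {{a..} \<times> {..b} | a b. True}"
    by auto
  finally show ?thesis
    by simp
qed

text \<open>On the half plane \<open>s < t\<close> the measures \<open>(t - s) (\<alpha> \<otimes> \<beta>)\<close> and \<open>(t - s) (\<beta> \<otimes> \<alpha>)\<close> agree on quadrants, hence
  coincide; dividing by the positive density, \<open>\<alpha> \<otimes> \<beta>\<close> is symmetric off the diagonal. It is trivially
  symmetric on the diagonal, so it gives \<open>B \<times> UNIV\<close> and \<open>UNIV \<times> B\<close> the same mass.\<close>

lemma proportional_measures:
  fixes \<alpha> \<beta> :: "real measure"
  assumes fin: "finite_measure \<alpha>" "finite_measure \<beta>"
    and [measurable_cong, simp]: "sets \<alpha> = sets borel" "sets \<beta> = sets borel"
    and eq: "\<And>a b. (\<integral>x. x * indicator {a..b} x \<partial>\<alpha>) * measure \<beta> {a..b} =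
                   (\<integral>x. x * indicator {a..b} x \<partial>\<beta>) * measure \<alpha> {a..b}"
    and B [measurable]: "B \<in> sets borel"
  shows "measure \<alpha> B * measure \<beta> UNIV = measure \<beta> B * measure \<alpha> UNIV"
proof -
  interpret \<alpha>: finite_measure \<alpha> by fact
  interpret \<beta>: finite_measure \<beta> by fact
  interpret P: pair_sigma_finite \<alpha> \<beta> ..
  interpret Q: pair_sigma_finite \<beta> \<alpha> ..
  have [simp]: "space \<alpha> = UNIV" "space \<beta> = UNIV"
    using sets_eq_imp_space_eq[of \<alpha> borel] sets_eq_imp_space_eq[of \<beta> borel] by auto
  define f :: "real \<times> real \<Rightarrow> ennreal" where "f z = ennreal (snd z - fst z)" for z
  have f_meas [measurable]: "f \<in> borel_measurable (borel \<Otimes>\<^sub>M borel)"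
    unfolding f_def[abs_def] by measurable
  have density_eq: "density (\<alpha> \<Otimes>\<^sub>M \<beta>) f = density (\<beta> \<Otimes>\<^sub>M \<alpha>) f"
  proof (rule measure_eqI_generator_eq)
    let ?E = "{{a..} \<times> {..b} | (a :: real) (b :: real). True}"
    let ?A = "\<lambda>n. {- real n..} \<times> {..real n}"
    show "Int_stable ?E"
    proof (rule Int_stableI)
      fix U V :: "(real \<times> real) set" assume "U \<in> ?E" "V \<in> ?E"
      then obtain a b c d where "U = {a..} \<times> {..b}" "V = {c..} \<times> {..d}" by blast
      then have "U \<inter> V = {max a c..} \<times> {..min b d}" by auto
      then show "U \<inter> V \<in> ?E" by blast
    qed
    show "emeasure (density (\<alpha> \<Otimes>\<^sub>M \<beta>) f) U = emeasure (density (\<beta> \<Otimes>\<^sub>M \<alpha>) f) U" if UE: "U \<in> ?E" for U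
    proof -
      obtain a b where U: "U = {a..} \<times> {..b}" using UE by blast
      show ?thesis
        using nn_integral_antisymmetric_part(1)[OF fin assms(3,4) eq, of a b]
        by (subst (1 2) emeasure_density) (auto simp: U f_def)
    qed
    show "emeasure (density (\<alpha> \<Otimes>\<^sub>M \<beta>) f) (?A n) \<noteq> \<infinity>" for n
      using nn_integral_antisymmetric_part(2)[OF fin assms(3,4) eq, of "- real n" "real n"]
      by (subst emeasure_density) (auto simp: f_def)
    show "range ?A \<subseteq> ?E" by blast
    show "(\<Union>n. ?A n) = UNIV"
    proof (intro equalityI subsetI UNIV_I)
      fix z :: "real \<times> real"
      obtain n where "max (- fst z) (snd z) \<le> real n" using real_arch_simple by blast
      then show "z \<in> (\<Union>n. ?A n)" by (cases z) (auto intro!: exI[of _ n])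
    qed
    show "sets (density (\<alpha> \<Otimes>\<^sub>M \<beta>) f) = sigma_sets UNIV ?E"
      using sets_pair_measure_cong[OF assms(3,4)] by (simp add: sets_pair_half_lines)
    show "sets (density (\<beta> \<Otimes>\<^sub>M \<alpha>) f) = sigma_sets UNIV ?E"
      using sets_pair_measure_cong[OF assms(4,3)] by (simp add: sets_pair_half_lines)
  qed simp
  have above_eq: "emeasure (\<alpha> \<Otimes>\<^sub>M \<beta>) G = emeasure (\<beta> \<Otimes>\<^sub>M \<alpha>) G"
    if [measurable]: "G \<in> sets (borel \<Otimes>\<^sub>M borel)" and G: "G \<subseteq> {z. fst z < snd z}" for G
  proof -
    have *: "indicator G z = f z * (indicator G z * inverse (f z))" for z
    proof (cases "z \<in> G")
      case True
      then have "0 < f z" "f z < \<infinity>" using G by (auto simp: f_def)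
      then have "f z * inverse (f z) = 1"
        using ennreal_divide_self[of "f z"] by (simp add: divide_ennreal_def)
      then show ?thesis using True by simp
    qed simp
    have "emeasure (\<alpha> \<Otimes>\<^sub>M \<beta>) G = (\<integral>\<^sup>+z. indicator G z * inverse (f z) \<partial>density (\<alpha> \<Otimes>\<^sub>M \<beta>) f)"
      by (subst nn_integral_density) (auto simp: *[symmetric])
    also have "\<dots> = emeasure (\<beta> \<Otimes>\<^sub>M \<alpha>) G"
      unfolding density_eq by (subst nn_integral_density) (auto simp: *[symmetric])
    finally show ?thesis .
  qed
  have swap: "emeasure (\<alpha> \<Otimes>\<^sub>M \<beta>) G = emeasure (\<beta> \<Otimes>\<^sub>M \<alpha>) ((\<lambda>(x, y). (y, x)) -` G)"
    if [measurable]: "G \<in> sets (borel \<Otimes>\<^sub>M borel)" for G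
    by (subst P.distr_pair_swap, subst emeasure_distr) (auto simp: space_pair_measure)
  have [measurable]: "{z :: real \<times> real. fst z < snd z} \<in> sets (borel \<Otimes>\<^sub>M borel)"
    "{z :: real \<times> real. fst z = snd z} \<in> sets (borel \<Otimes>\<^sub>M borel)"
    "{z :: real \<times> real. snd z < fst z} \<in> sets (borel \<Otimes>\<^sub>M borel)"
    unfolding borel_prod
    by (intro borel_open open_Collect_less borel_closed[OF closed_Collect_eq] continuous_intros)+
  have split: "emeasure (\<alpha> \<Otimes>\<^sub>M \<beta>) G = emeasure (\<alpha> \<Otimes>\<^sub>M \<beta>) (G \<inter> {z. fst z < snd z})
      + emeasure (\<alpha> \<Otimes>\<^sub>M \<beta>) (G \<inter> {z. fst z = snd z}) + emeasure (\<alpha> \<Otimes>\<^sub>M \<beta>) (G \<inter> {z. snd z < fst z})"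
    if [measurable]: "G \<in> sets (borel \<Otimes>\<^sub>M borel)" for G
  proof -
    have "emeasure (\<alpha> \<Otimes>\<^sub>M \<beta>) G = emeasure (\<alpha> \<Otimes>\<^sub>M \<beta>)
        ((G \<inter> {z. fst z < snd z} \<union> G \<inter> {z. fst z = snd z}) \<union> G \<inter> {z. snd z < fst z})"
      by (rule arg_cong[where f="emeasure _"]) auto
    also have "\<dots> = emeasure (\<alpha> \<Otimes>\<^sub>M \<beta>) (G \<inter> {z. fst z < snd z} \<union> G \<inter> {z. fst z = snd z})
        + emeasure (\<alpha> \<Otimes>\<^sub>M \<beta>) (G \<inter> {z. snd z < fst z})"
      by (rule plus_emeasure[symmetric]) auto
    also have "emeasure (\<alpha> \<Otimes>\<^sub>M \<beta>) (G \<inter> {z. fst z < snd z} \<union> G \<inter> {z. fst z = snd z})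
        = emeasure (\<alpha> \<Otimes>\<^sub>M \<beta>) (G \<inter> {z. fst z < snd z}) + emeasure (\<alpha> \<Otimes>\<^sub>M \<beta>) (G \<inter> {z. fst z = snd z})"
      by (rule plus_emeasure[symmetric]) auto
    finally show ?thesis .
  qed
  have flip1: "emeasure (\<alpha> \<Otimes>\<^sub>M \<beta>) ((C \<times> D) \<inter> {z. snd z < fst z}) = emeasure (\<alpha> \<Otimes>\<^sub>M \<beta>) ((D \<times> C) \<inter> {z. fst z < snd z})"
    if [measurable]: "C \<in> sets borel" "D \<in> sets borel" for C D
  proof -
    have "emeasure (\<alpha> \<Otimes>\<^sub>M \<beta>) ((C \<times> D) \<inter> {z. snd z < fst z}) = emeasure (\<beta> \<Otimes>\<^sub>M \<alpha>) ((D \<times> C) \<inter> {z. fst z < snd z})"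
      by (subst swap) (auto intro!: arg_cong[where f="emeasure _"])
    then show ?thesis
      by (subst above_eq) auto
  qed
  have "emeasure (\<alpha> \<Otimes>\<^sub>M \<beta>) (B \<times> UNIV) = emeasure (\<alpha> \<Otimes>\<^sub>M \<beta>) (UNIV \<times> B)"
  proof -
    have "(B \<times> UNIV) \<inter> {z. fst z = snd z} = (UNIV \<times> B) \<inter> {z. fst z = snd z}"
      by auto
    then show ?thesis
      by (subst (1 2) split) (auto simp: flip1 add_ac)
  qed
  then have "emeasure \<alpha> B * emeasure \<beta> UNIV = emeasure \<alpha> UNIV * emeasure \<beta> B"
    by (subst (asm) (1 2) \<beta>.emeasure_pair_measure_Times) auto
  then show ?thesis
    by (simp add: \<alpha>.emeasure_eq_measure \<beta>.emeasure_eq_measure ennreal_mult[symmetric] mult.commute)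
qed

text \<open>The form in which proportionality is applied: the two measures are the images under \<open>Z\<close> of
  \<open>M\<close> weighted by \<open>w\<^sub>1\<close> and by \<open>w\<^sub>2\<close>.\<close>

lemma (in finite_measure) proportional_weights:
  fixes Z w\<^sub>1 w\<^sub>2 :: "'a \<Rightarrow> real"
  assumes [measurable]: "Z \<in> borel_measurable M" and w: "integrable M w\<^sub>1" "integrable M w\<^sub>2"
    and nonneg: "\<And>\<omega>. 0 \<le> w\<^sub>1 \<omega>" "\<And>\<omega>. 0 \<le> w\<^sub>2 \<omega>"
    and eq: "\<And>a b. (\<integral>\<omega>. Z \<omega> * w\<^sub>1 \<omega> * indicator {a..b} (Z \<omega>) \<partial>M) * (\<integral>\<omega>. w\<^sub>2 \<omega> * indicator {a..b} (Z \<omega>) \<partial>M) =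
                   (\<integral>\<omega>. Z \<omega> * w\<^sub>2 \<omega> * indicator {a..b} (Z \<omega>) \<partial>M) * (\<integral>\<omega>. w\<^sub>1 \<omega> * indicator {a..b} (Z \<omega>) \<partial>M)"
    and B [measurable]: "B \<in> sets borel"
  shows "(\<integral>\<omega>. w\<^sub>1 \<omega> * indicator B (Z \<omega>) \<partial>M) * (\<integral>\<omega>. w\<^sub>2 \<omega> \<partial>M) =
         (\<integral>\<omega>. w\<^sub>2 \<omega> * indicator B (Z \<omega>) \<partial>M) * (\<integral>\<omega>. w\<^sub>1 \<omega> \<partial>M)"
proof -
  define \<mu> where "\<mu> w = distr (density M (\<lambda>\<omega>. ennreal (w \<omega>))) borel Z" for w :: "'a \<Rightarrow> real"
  have \<mu>: "finite_measure (\<mu> w) \<and> sets (\<mu> w) = sets borel \<and>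
      (\<forall>g\<in>borel_measurable borel. (\<integral>x. g x \<partial>\<mu> w) = (\<integral>\<omega>. g (Z \<omega>) * w \<omega> \<partial>M)) \<and>
      (\<forall>C\<in>sets borel. measure (\<mu> w) C = (\<integral>\<omega>. w \<omega> * indicator C (Z \<omega>) \<partial>M))"
    if w: "integrable M w" and nn: "\<And>\<omega>. 0 \<le> w \<omega>" for w
  proof -
    have [measurable]: "w \<in> borel_measurable M" using w by auto
    have fin: "finite_measure (density M (\<lambda>\<omega>. ennreal (w \<omega>)))"
      using w nn by (intro finite_measureI) (auto simp: emeasure_density nn_integral_eq_integral cong: nn_integral_cong)
    have int: "(\<integral>x. g x \<partial>\<mu> w) = (\<integral>\<omega>. g (Z \<omega>) * w \<omega> \<partial>M)"
      if [measurable]: "g \<in> borel_measurable borel" for g :: "real \<Rightarrow> real"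
      unfolding \<mu>_def using nn
      by (subst integral_distr) (auto simp: integral_density mult.commute)
    have fin': "finite_measure (\<mu> w)"
      unfolding \<mu>_def by (rule finite_measure.finite_measure_distr[OF fin]) simp
    moreover have "measure (\<mu> w) C = (\<integral>\<omega>. w \<omega> * indicator C (Z \<omega>) \<partial>M)" if "C \<in> sets borel" for C
      using int[of "indicator C"] that by (simp add: mult.commute \<mu>_def)
    ultimately show ?thesis
      using int by (auto simp: \<mu>_def)
  qed
  note \<mu>1 = \<mu>[OF w(1) nonneg(1)] and \<mu>2 = \<mu>[OF w(2) nonneg(2)]
  have "measure (\<mu> w\<^sub>1) B * measure (\<mu> w\<^sub>2) UNIV = measure (\<mu> w\<^sub>2) B * measure (\<mu> w\<^sub>1) UNIV"
  proof (rule proportional_measures[OF _ _ _ _ _ B])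
    show "(\<integral>x. x * indicator {a..b} x \<partial>\<mu> w\<^sub>1) * measure (\<mu> w\<^sub>2) {a..b} =
          (\<integral>x. x * indicator {a..b} x \<partial>\<mu> w\<^sub>2) * measure (\<mu> w\<^sub>1) {a..b}" for a b
      using eq[of a b] \<mu>1 \<mu>2 by (simp add: mult_ac)
  qed (use \<mu>1 \<mu>2 in auto)
  then show ?thesis
    using \<mu>1 \<mu>2 by simp
qed

section \<open>From vanishing covariance to local independence\<close>

definition rect_prob :: "'a measure \<Rightarrow> ('a \<Rightarrow> real) \<Rightarrow> ('a \<Rightarrow> real) \<Rightarrow> real set \<Rightarrow> real set \<Rightarrow> real" where
  "rect_prob M X Y B C = measure M {\<omega> \<in> space M. X \<omega> \<in> B \<and> Y \<omega> \<in> C}"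

text \<open>Conditional independence of \<open>X\<close> and \<open>Y\<close> given \<open>X \<in> I\<close> and \<open>Y \<in> J\<close>, with denominators cleared so that a
  rectangle \<open>I \<times> J\<close> of probability zero is included.\<close>

definition factorizes_on :: "'a measure \<Rightarrow> ('a \<Rightarrow> real) \<Rightarrow> ('a \<Rightarrow> real) \<Rightarrow> real set \<Rightarrow> real set \<Rightarrow> bool" where
  "factorizes_on M X Y I J \<longleftrightarrow> (\<forall>B\<in>sets borel. \<forall>C\<in>sets borel. B \<subseteq> I \<longrightarrow> C \<subseteq> J \<longrightarrow>
     rect_prob M X Y B C * rect_prob M X Y I J = rect_prob M X Y B J * rect_prob M X Y I C)"

definition rect_indicator :: "('a \<Rightarrow> real) \<Rightarrow> ('a \<Rightarrow> real) \<Rightarrow> real set \<Rightarrow> real set \<Rightarrow> 'a \<Rightarrow> real" where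
  "rect_indicator X Y B C \<omega> = indicator B (X \<omega>) * indicator C (Y \<omega>)"

lemma measurable_rect_indicator [measurable (raw)]:
  assumes [measurable]: "X \<in> borel_measurable M" "Y \<in> borel_measurable M" "B \<in> sets borel" "C \<in> sets borel"
  shows "rect_indicator X Y B C \<in> borel_measurable M"
  unfolding rect_indicator_def[abs_def] by measurable

context prob_space
begin

lemma expectation_rect_indicator:
  assumes [measurable]: "X \<in> borel_measurable M" "Y \<in> borel_measurable M" "B \<in> sets borel" "C \<in> sets borel"
  shows "expectation (rect_indicator X Y B C) = rect_prob M X Y B C"
proof -
  have "expectation (rect_indicator X Y B C) = expectation (indicator {\<omega> \<in> space M. X \<omega> \<in> B \<and> Y \<omega> \<in> C})"
    by (rule Bochner_Integration.integral_cong) (auto simp: rect_indicator_def indicator_def)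
  then show ?thesis
    by (simp add: rect_prob_def)
qed

lemma integrable_rect_indicator:
  assumes [measurable]: "X \<in> borel_measurable M" "Y \<in> borel_measurable M" "B \<in> sets borel" "C \<in> sets borel"
    and sub: "B \<subseteq> {a..b}" "C \<subseteq> {c..d}"
  shows "integrable M (rect_indicator X Y B C)"
    and "integrable M (\<lambda>\<omega>. X \<omega> * rect_indicator X Y B C \<omega>)"
    and "integrable M (\<lambda>\<omega>. Y \<omega> * rect_indicator X Y B C \<omega>)"
    and "integrable M (\<lambda>\<omega>. X \<omega> * Y \<omega> * rect_indicator X Y B C \<omega>)"
proof -
  have bx: "\<bar>X \<omega>\<bar> \<le> \<bar>a\<bar> + \<bar>b\<bar>" if "X \<omega> \<in> B" for \<omega> using that sub by fastforce
  have b_y: "\<bar>Y \<omega>\<bar> \<le> \<bar>c\<bar> + \<bar>d\<bar>" if "Y \<omega> \<in> C" for \<omega> using that sub by fastforce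
  have bxy: "\<bar>X \<omega>\<bar> * \<bar>Y \<omega>\<bar> \<le> (\<bar>a\<bar> + \<bar>b\<bar>) * (\<bar>c\<bar> + \<bar>d\<bar>)" if "X \<omega> \<in> B" "Y \<omega> \<in> C" for \<omega>
    using bx[OF that(1)] b_y[OF that(2)] by (intro mult_mono) auto
  show "integrable M (rect_indicator X Y B C)"
    by (rule integrable_const_bound[where B=1]) (auto simp: rect_indicator_def indicator_def)
  show "integrable M (\<lambda>\<omega>. X \<omega> * rect_indicator X Y B C \<omega>)"
    by (rule integrable_const_bound[where B="\<bar>a\<bar> + \<bar>b\<bar>"]) (auto simp: rect_indicator_def indicator_def bx)
  show "integrable M (\<lambda>\<omega>. Y \<omega> * rect_indicator X Y B C \<omega>)"
    by (rule integrable_const_bound[where B="\<bar>c\<bar> + \<bar>d\<bar>"]) (auto simp: rect_indicator_def indicator_def b_y)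
  show "integrable M (\<lambda>\<omega>. X \<omega> * Y \<omega> * rect_indicator X Y B C \<omega>)"
    by (rule integrable_const_bound[where B="(\<bar>a\<bar> + \<bar>b\<bar>) * (\<bar>c\<bar> + \<bar>d\<bar>)"])
      (auto simp: rect_indicator_def indicator_def bxy abs_mult)
qed

text \<open>Vanishing of the conditional covariance, again with denominators cleared.\<close>

definition uncorrelated_on :: "('a \<Rightarrow> real) \<Rightarrow> ('a \<Rightarrow> real) \<Rightarrow> real set \<Rightarrow> real set \<Rightarrow> bool" where
  "uncorrelated_on X Y I J \<longleftrightarrow>
     expectation (\<lambda>\<omega>. X \<omega> * Y \<omega> * rect_indicator X Y I J \<omega>) * expectation (rect_indicator X Y I J) =
     expectation (\<lambda>\<omega>. X \<omega> * rect_indicator X Y I J \<omega>) * expectation (\<lambda>\<omega>. Y \<omega> * rect_indicator X Y I J \<omega>)"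

lemma event_cov_rect:
  assumes [measurable]: "X \<in> borel_measurable M" "Y \<in> borel_measurable M" "I \<in> sets borel" "J \<in> sets borel"
    and U: "U = {\<omega> \<in> space M. X \<omega> \<in> I \<and> Y \<omega> \<in> J}" and pos: "prob U > 0"
  shows "event_cov M U X Y = 0 \<longleftrightarrow> uncorrelated_on X Y I J"
proof -
  have ind: "(\<integral>\<omega>. Z \<omega> * indicator U \<omega> \<partial>M) = expectation (\<lambda>\<omega>. Z \<omega> * rect_indicator X Y I J \<omega>)" for Z :: "'a \<Rightarrow> real"
    by (rule Bochner_Integration.integral_cong) (auto simp: U rect_indicator_def indicator_def)
  have "expectation (rect_indicator X Y I J) = prob U"
    by (subst expectation_rect_indicator) (auto simp: rect_prob_def U)
  then show ?thesis
    using pos unfolding event_cov_def event_expectation_def uncorrelated_on_def ind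
    by (simp add: field_simps)
qed

text \<open>With denominators cleared, the condition also holds for rectangles of probability zero and for
  degenerate ones, where one of the variables is constant. This lets small rectangles be intersected
  freely in what follows.\<close>

lemma uncorrelated_on_small_intervals:
  assumes [measurable]: "X \<in> borel_measurable M" "Y \<in> borel_measurable M"
    and lu: "locally_uncorrelated M X Y"
  obtains \<epsilon> where "\<epsilon> > 0"
    and "\<And>a b c d. b - a \<le> \<epsilon> \<Longrightarrow> d - c \<le> \<epsilon> \<Longrightarrow> uncorrelated_on X Y {a..b} {c..d}"
proof -
  obtain \<epsilon> where "\<epsilon> > 0" and cov: "\<And>a b c d U. a < b \<Longrightarrow> c < d \<Longrightarrow> max (b - a) (d - c) \<le> \<epsilon> \<Longrightarrow>
        U = {\<omega> \<in> space M. X \<omega> \<in> {a..b} \<and> Y \<omega> \<in> {c..d}} \<Longrightarrow> prob U > 0 \<Longrightarrow> event_cov M U X Y = 0"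
    using lu unfolding locally_uncorrelated_def Let_def by blast
  have "uncorrelated_on X Y {a..b} {c..d}" if "b - a \<le> \<epsilon>" "d - c \<le> \<epsilon>" for a b c d
  proof -
    let ?r = "rect_indicator X Y {a..b} {c..d}"
    let ?U = "{\<omega> \<in> space M. X \<omega> \<in> {a..b} \<and> Y \<omega> \<in> {c..d}}"
    consider "a \<ge> b" | "c \<ge> d" | "a < b" "c < d" "prob ?U > 0" | "prob ?U = 0"
      using measure_nonneg[of M ?U] by linarith
    then show ?thesis
    proof cases
      case 1
      then have eqs: "(\<lambda>\<omega>. X \<omega> * ?r \<omega>) = (\<lambda>\<omega>. a * ?r \<omega>)"
          "(\<lambda>\<omega>. X \<omega> * Y \<omega> * ?r \<omega>) = (\<lambda>\<omega>. a * (Y \<omega> * ?r \<omega>))"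
        by (auto simp: rect_indicator_def indicator_def fun_eq_iff)
      show ?thesis unfolding uncorrelated_on_def eqs by simp
    next
      case 2
      then have eqs: "(\<lambda>\<omega>. Y \<omega> * ?r \<omega>) = (\<lambda>\<omega>. c * ?r \<omega>)"
          "(\<lambda>\<omega>. X \<omega> * Y \<omega> * ?r \<omega>) = (\<lambda>\<omega>. c * (X \<omega> * ?r \<omega>))"
        by (auto simp: rect_indicator_def indicator_def fun_eq_iff)
      show ?thesis unfolding uncorrelated_on_def eqs by simp
    next
      case 3
      then show ?thesis
        using that cov[OF _ _ _ refl, of a b c d] event_cov_rect[of X Y "{a..b}" "{c..d}" ?U] by simp
    next
      case 4
      have "AE \<omega> in M. \<omega> \<notin> ?U"
        using 4 by (intro AE_not_in) (auto simp: null_sets_def emeasure_eq_measure)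
      with AE_space have "AE \<omega> in M. ?r \<omega> = 0"
        by eventually_elim (auto simp: rect_indicator_def indicator_def)
      then have "expectation (\<lambda>\<omega>. Z \<omega> * ?r \<omega>) = 0" for Z :: "'a \<Rightarrow> real"
        by (intro integral_eq_zero_AE) auto
      from this[of "\<lambda>_. 1"] this[of X] this[of "\<lambda>\<omega>. X \<omega> * Y \<omega>"] show ?thesis
        by (simp add: uncorrelated_on_def)
    qed
  qed
  with \<open>\<epsilon> > 0\<close> that show ?thesis by blast
qed

text \<open>The law of \<open>X\<close> on the rectangle and the same law weighted by \<open>Y\<close> have equal barycentres on every interval, so they are proportional,
  and the ratio of their masses on \<open>B\<close> is the conditional mean of \<open>Y\<close>.
  Since weights must be nonnegative, \<open>Y - c\<close> is used in place of \<open>Y\<close>; covariance is invariant under the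
  shift.\<close>

lemma conditional_mean_constant:
  assumes [measurable]: "X \<in> borel_measurable M" "Y \<in> borel_measurable M"
    and unc: "\<And>a' b'. a \<le> a' \<Longrightarrow> b' \<le> b \<Longrightarrow> uncorrelated_on X Y {a'..b'} {c..d}"
    and B [measurable]: "B \<in> sets borel" and BI: "B \<subseteq> {a..b}"
  shows "expectation (\<lambda>\<omega>. Y \<omega> * rect_indicator X Y B {c..d} \<omega>) * rect_prob M X Y {a..b} {c..d} =
         rect_prob M X Y B {c..d} * expectation (\<lambda>\<omega>. Y \<omega> * rect_indicator X Y {a..b} {c..d} \<omega>)"
proof -
  let ?r = "\<lambda>B. rect_indicator X Y B {c..d}"
  have int0: "integrable M (?r B)" "integrable M (\<lambda>\<omega>. X \<omega> * ?r B \<omega>)"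
    "integrable M (\<lambda>\<omega>. Y \<omega> * ?r B \<omega>)" "integrable M (\<lambda>\<omega>. X \<omega> * Y \<omega> * ?r B \<omega>)"
    if "B \<in> sets borel" "B \<subseteq> {a..b}" for B
    using integrable_rect_indicator[where a=a and b=b and c=c and d=d and B=B and C="{c..d}"] that by auto
  have shift: "expectation (\<lambda>\<omega>. (Y \<omega> - c) * ?r B \<omega>) = expectation (\<lambda>\<omega>. Y \<omega> * ?r B \<omega>) - c * expectation (?r B)"
    if "B \<in> sets borel" "B \<subseteq> {a..b}" for B
    using int0[OF that] by (simp add: left_diff_distrib)
  have shiftX: "expectation (\<lambda>\<omega>. X \<omega> * (Y \<omega> - c) * ?r B \<omega>)
      = expectation (\<lambda>\<omega>. X \<omega> * Y \<omega> * ?r B \<omega>) - c * expectation (\<lambda>\<omega>. X \<omega> * ?r B \<omega>)"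
    if "B \<in> sets borel" "B \<subseteq> {a..b}" for B
  proof -
    have "expectation (\<lambda>\<omega>. X \<omega> * (Y \<omega> - c) * ?r B \<omega>)
       = expectation (\<lambda>\<omega>. X \<omega> * Y \<omega> * ?r B \<omega> - c * (X \<omega> * ?r B \<omega>))"
      by (rule Bochner_Integration.integral_cong) (auto simp: algebra_simps)
    then show ?thesis
      using int0[OF that] by simp
  qed
  have r_Int: "?r {a..b} \<omega> * indicator C (X \<omega>) = ?r ({a..b} \<inter> C) \<omega>" for C \<omega>
    by (auto simp: rect_indicator_def indicator_def)
  have "expectation (\<lambda>\<omega>. (Y \<omega> - c) * ?r {a..b} \<omega> * indicator B (X \<omega>)) * expectation (?r {a..b}) =
        expectation (\<lambda>\<omega>. ?r {a..b} \<omega> * indicator B (X \<omega>)) * expectation (\<lambda>\<omega>. (Y \<omega> - c) * ?r {a..b} \<omega>)"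
  proof (rule proportional_weights)
    show "integrable M (\<lambda>\<omega>. (Y \<omega> - c) * ?r {a..b} \<omega>)" "integrable M (?r {a..b})"
      using int0[of "{a..b}"] by (auto simp: left_diff_distrib)
    show "0 \<le> (Y \<omega> - c) * ?r {a..b} \<omega>" "0 \<le> ?r {a..b} \<omega>" for \<omega>
      by (auto simp: rect_indicator_def indicator_def)
    fix a\<^sub>1 b\<^sub>1
    define I where "I = {max a a\<^sub>1..min b b\<^sub>1}"
    have I: "I \<in> sets borel" "I \<subseteq> {a..b}" "{a..b} \<inter> {a\<^sub>1..b\<^sub>1} = I"
      by (auto simp: I_def)
    have "uncorrelated_on X Y I {c..d}"
      unfolding I_def by (rule unc) auto
    then show "expectation (\<lambda>\<omega>. X \<omega> * ((Y \<omega> - c) * ?r {a..b} \<omega>) * indicator {a\<^sub>1..b\<^sub>1} (X \<omega>)) *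
        expectation (\<lambda>\<omega>. ?r {a..b} \<omega> * indicator {a\<^sub>1..b\<^sub>1} (X \<omega>)) =
      expectation (\<lambda>\<omega>. X \<omega> * ?r {a..b} \<omega> * indicator {a\<^sub>1..b\<^sub>1} (X \<omega>)) *
        expectation (\<lambda>\<omega>. (Y \<omega> - c) * ?r {a..b} \<omega> * indicator {a\<^sub>1..b\<^sub>1} (X \<omega>))"
      unfolding uncorrelated_on_def mult.assoc r_Int I(3) shift[OF I(1,2)]
        shiftX[OF I(1,2), unfolded mult.assoc]
      by (simp add: algebra_simps)
  qed auto
  moreover have "{a..b} \<inter> B = B" using BI by auto
  ultimately have eq: "expectation (\<lambda>\<omega>. (Y \<omega> - c) * ?r B \<omega>) * expectation (?r {a..b}) =
        expectation (?r B) * expectation (\<lambda>\<omega>. (Y \<omega> - c) * ?r {a..b} \<omega>)"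
    unfolding mult.assoc r_Int by simp
  have shift_whole: "expectation (\<lambda>\<omega>. (Y \<omega> - c) * ?r {a..b} \<omega>)
      = expectation (\<lambda>\<omega>. Y \<omega> * ?r {a..b} \<omega>) - c * expectation (?r {a..b})"
    by (rule shift) auto
  show ?thesis
    using eq unfolding shift[OF B BI] shift_whole by (simp add: expectation_rect_indicator algebra_simps)
qed

text \<open>A second use of proportionality. The laws of \<open>Y\<close> on \<open>B \<times> {c..d}\<close> and on \<open>{a..b} \<times> {c..d}\<close> have equal
  barycentres on each subinterval of \<open>{c..d}\<close>, by constancy of the conditional mean, so these two laws
  are proportional.\<close>

lemma factorizes_on_if_uncorrelated:
  assumes [measurable]: "X \<in> borel_measurable M" "Y \<in> borel_measurable M"
    and unc: "\<And>a' b' c' d'. a \<le> a' \<Longrightarrow> b' \<le> b \<Longrightarrow> c \<le> c' \<Longrightarrow> d' \<le> d \<Longrightarrow>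
                uncorrelated_on X Y {a'..b'} {c'..d'}"
  shows "factorizes_on M X Y {a..b} {c..d}"
  unfolding factorizes_on_def
proof (intro ballI impI)
  fix B C :: "real set"
  assume [measurable]: "B \<in> sets borel" "C \<in> sets borel" and sub: "B \<subseteq> {a..b}" "C \<subseteq> {c..d}"
  let ?r = "rect_indicator X Y"
  have r_Int: "?r A {c..d} \<omega> * indicator D (Y \<omega>) = ?r A ({c..d} \<inter> D) \<omega>" for A D \<omega>
    by (auto simp: rect_indicator_def indicator_def)
  have "expectation (\<lambda>\<omega>. ?r B {c..d} \<omega> * indicator C (Y \<omega>)) * expectation (?r {a..b} {c..d}) =
        expectation (\<lambda>\<omega>. ?r {a..b} {c..d} \<omega> * indicator C (Y \<omega>)) * expectation (?r B {c..d})"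
  proof (rule proportional_weights)
    show "integrable M (?r B {c..d})" "integrable M (?r {a..b} {c..d})"
      using sub by (auto intro: integrable_rect_indicator(1)[where a=a and b=b and c=c and d=d])
    show "0 \<le> ?r B {c..d} \<omega>" "0 \<le> ?r {a..b} {c..d} \<omega>" for \<omega>
      by (auto simp: rect_indicator_def)
    fix c\<^sub>1 d\<^sub>1
    have J: "{c..d} \<inter> {c\<^sub>1..d\<^sub>1} = {max c c\<^sub>1..min d d\<^sub>1}" by auto
    show "expectation (\<lambda>\<omega>. Y \<omega> * ?r B {c..d} \<omega> * indicator {c\<^sub>1..d\<^sub>1} (Y \<omega>)) *
        expectation (\<lambda>\<omega>. ?r {a..b} {c..d} \<omega> * indicator {c\<^sub>1..d\<^sub>1} (Y \<omega>)) =
      expectation (\<lambda>\<omega>. Y \<omega> * ?r {a..b} {c..d} \<omega> * indicator {c\<^sub>1..d\<^sub>1} (Y \<omega>)) *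
        expectation (\<lambda>\<omega>. ?r B {c..d} \<omega> * indicator {c\<^sub>1..d\<^sub>1} (Y \<omega>))"
      unfolding mult.assoc r_Int J
      using conditional_mean_constant[of X Y a b "max c c\<^sub>1" "min d d\<^sub>1" B, OF _ _ unc] sub
      by (simp add: expectation_rect_indicator mult.commute)
  qed auto
  moreover have "{c..d} \<inter> C = C" using sub by auto
  ultimately show "rect_prob M X Y B C * rect_prob M X Y {a..b} {c..d} =
      rect_prob M X Y B {c..d} * rect_prob M X Y {a..b} C"
    unfolding r_Int by (simp add: expectation_rect_indicator mult.commute)
qed

section \<open>Gluing local independence along overlapping intervals\<close>

lemma rect_prob_swap: "rect_prob M Y X C B = rect_prob M X Y B C"
  unfolding rect_prob_def by (rule arg_cong[where f=prob]) auto

lemma factorizes_on_swap: "factorizes_on M Y X J I \<longleftrightarrow> factorizes_on M X Y I J"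
  unfolding factorizes_on_def rect_prob_swap[of Y X] by (auto simp: mult.commute)

lemma rect_prob_nonneg: "0 \<le> rect_prob M X Y B C"
  by (simp add: rect_prob_def)

lemma rect_prob_mono:
  assumes [measurable]: "X \<in> borel_measurable M" "Y \<in> borel_measurable M" "B' \<in> sets borel" "C' \<in> sets borel"
    and "B \<subseteq> B'" "C \<subseteq> C'"
  shows "rect_prob M X Y B C \<le> rect_prob M X Y B' C'"
  unfolding rect_prob_def using assms by (intro finite_measure_mono) auto

lemma rect_prob_split:
  assumes [measurable]: "X \<in> borel_measurable M" "Y \<in> borel_measurable M"
    "B \<in> sets borel" "I \<in> sets borel" "C \<in> sets borel"
  shows "rect_prob M X Y B C = rect_prob M X Y (B \<inter> I) C + rect_prob M X Y (B - I) C"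
  unfolding rect_prob_def
  by (subst finite_measure_Union[symmetric]) (auto intro!: arg_cong[where f=prob])

text \<open>On each of the two strips the conditional law of \<open>Y\<close> given the position of \<open>X\<close> is constant; both
  constants equal the conditional law on the overlap, which is well defined because the overlap has
  positive probability.\<close>

lemma factorizes_on_Un:
  assumes [measurable]: "X \<in> borel_measurable M" "Y \<in> borel_measurable M"
    "I\<^sub>1 \<in> sets borel" "I\<^sub>2 \<in> sets borel" "J \<in> sets borel"
    and f: "factorizes_on M X Y I\<^sub>1 J" "factorizes_on M X Y I\<^sub>2 J"
    and pos: "rect_prob M X Y (I\<^sub>1 \<inter> I\<^sub>2) J > 0"
  shows "factorizes_on M X Y (I\<^sub>1 \<union> I\<^sub>2) J"
proof -
  let ?p = "rect_prob M X Y" and ?D = "I\<^sub>1 \<inter> I\<^sub>2"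
  have part: "?p B C * ?p ?D J = ?p B J * ?p ?D C"
    if I: "I = I\<^sub>1 \<or> I = I\<^sub>2" and [measurable]: "B \<in> sets borel" "C \<in> sets borel" and sub: "B \<subseteq> I" "C \<subseteq> J" for I B C
  proof -
    have fI: "factorizes_on M X Y I J" and [measurable]: "I \<in> sets borel" and "?D \<subseteq> I" using I f by auto
    have "?p ?D J \<le> ?p I J" using \<open>?D \<subseteq> I\<close> by (intro rect_prob_mono) auto
    with pos have "?p I J \<noteq> 0" by linarith
    moreover have "?p B C * ?p I J = ?p B J * ?p I C"
      using fI sub by (auto simp: factorizes_on_def)
    moreover have "?p ?D C * ?p I J = ?p ?D J * ?p I C"
      using fI sub \<open>?D \<subseteq> I\<close> by (auto simp: factorizes_on_def)
    ultimately show ?thesis by algebra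
  qed
  have whole: "?p B C * ?p ?D J = ?p B J * ?p ?D C"
    if [measurable]: "B \<in> sets borel" "C \<in> sets borel" and sub: "B \<subseteq> I\<^sub>1 \<union> I\<^sub>2" "C \<subseteq> J" for B C
  proof -
    have "?p (B \<inter> I\<^sub>1) C * ?p ?D J = ?p (B \<inter> I\<^sub>1) J * ?p ?D C"
      using sub by (intro part[of I\<^sub>1]) auto
    moreover have "?p (B - I\<^sub>1) C * ?p ?D J = ?p (B - I\<^sub>1) J * ?p ?D C"
      using sub by (intro part[of I\<^sub>2]) auto
    ultimately show ?thesis
      using rect_prob_split[of X Y B I\<^sub>1 C] rect_prob_split[of X Y B I\<^sub>1 J] by (simp add: distrib_right)
  qed
  show ?thesis
    unfolding factorizes_on_def
  proof (intro ballI impI)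
    fix B C :: "real set"
    assume BC: "B \<in> sets borel" "C \<in> sets borel" "B \<subseteq> I\<^sub>1 \<union> I\<^sub>2" "C \<subseteq> J"
    have "?p (I\<^sub>1 \<union> I\<^sub>2) C * ?p ?D J = ?p (I\<^sub>1 \<union> I\<^sub>2) J * ?p ?D C"
      using BC by (intro whole) auto
    moreover have "?p ?D J \<noteq> 0" using pos by simp
    ultimately show "?p B C * ?p (I\<^sub>1 \<union> I\<^sub>2) J = ?p B J * ?p (I\<^sub>1 \<union> I\<^sub>2) C"
      using whole[OF BC] by algebra
  qed
qed

lemma factorizes_on_extend_null:
  assumes [measurable]: "X \<in> borel_measurable M" "Y \<in> borel_measurable M"
    "I \<in> sets borel" "I' \<in> sets borel" "J \<in> sets borel"
    and f: "factorizes_on M X Y I J" and "I \<subseteq> I'" and null: "rect_prob M X Y (I' - I) UNIV = 0"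
  shows "factorizes_on M X Y I' J"
proof -
  let ?p = "rect_prob M X Y"
  have restrict: "?p B C = ?p (B \<inter> I) C"
    if [measurable]: "B \<in> sets borel" "C \<in> sets borel" and "B \<subseteq> I'" for B C
  proof -
    have "?p (B - I) C \<le> ?p (I' - I) UNIV"
      using that by (intro rect_prob_mono) auto
    then have "?p (B - I) C = 0"
      using null rect_prob_nonneg[of X Y "B - I" C] by linarith
    then show ?thesis using rect_prob_split[of X Y B I C] by simp
  qed
  show ?thesis
    unfolding factorizes_on_def
  proof (intro ballI impI)
    fix B C :: "real set"
    assume BC: "B \<in> sets borel" "C \<in> sets borel" "B \<subseteq> I'" "C \<subseteq> J"
    have "I' \<inter> I = I" using \<open>I \<subseteq> I'\<close> by auto
    then show "?p B C * ?p I' J = ?p B J * ?p I' C"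
      using f BC restrict[of B C] restrict[of B J] restrict[of I' J] restrict[of I' C]
      by (simp add: factorizes_on_def)
  qed
qed

lemma factorizes_on_incseq:
  fixes I :: "nat \<Rightarrow> real set"
  assumes [measurable]: "X \<in> borel_measurable M" "Y \<in> borel_measurable M"
    "\<And>n. I n \<in> sets borel" "J \<in> sets borel"
    and f: "\<And>n. factorizes_on M X Y (I n) J" and inc: "incseq I" and un: "(\<Union>n. I n) = UNIV"
  shows "factorizes_on M X Y UNIV J"
  unfolding factorizes_on_def
proof (intro ballI impI)
  let ?p = "rect_prob M X Y"
  have lim: "(\<lambda>n. ?p (B \<inter> I n) C) \<longlonglongrightarrow> ?p B C"
    if [measurable]: "B \<in> sets borel" "C \<in> sets borel" for B C
  proof -
    let ?A = "\<lambda>n. {\<omega> \<in> space M. X \<omega> \<in> B \<inter> I n \<and> Y \<omega> \<in> C}"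
    have "(\<lambda>n. prob (?A n)) \<longlonglongrightarrow> prob (\<Union>n. ?A n)"
      using inc by (intro finite_Lim_measure_incseq) (auto simp: incseq_def)
    moreover have "(\<Union>n. ?A n) = {\<omega> \<in> space M. X \<omega> \<in> B \<and> Y \<omega> \<in> C}"
      using un by auto
    ultimately show ?thesis by (simp add: rect_prob_def)
  qed
  fix B C :: "real set"
  assume BC [measurable]: "B \<in> sets borel" "C \<in> sets borel" and sub: "B \<subseteq> UNIV" "C \<subseteq> J"
  have "?p (B \<inter> I n) C * ?p (UNIV \<inter> I n) J = ?p (B \<inter> I n) J * ?p (UNIV \<inter> I n) C" for n
    using f[of n] sub by (auto simp: factorizes_on_def)
  moreover have "(\<lambda>n. ?p (B \<inter> I n) C * ?p (UNIV \<inter> I n) J) \<longlonglongrightarrow> ?p B C * ?p UNIV J"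
    by (intro tendsto_mult lim) auto
  moreover have "(\<lambda>n. ?p (B \<inter> I n) J * ?p (UNIV \<inter> I n) C) \<longlonglongrightarrow> ?p B J * ?p UNIV C"
    by (intro tendsto_mult lim) auto
  ultimately show "?p B C * ?p UNIV J = ?p B J * ?p UNIV C"
    by (auto intro: LIMSEQ_unique)
qed

text \<open>Independence spreads from a point \<open>x\<^sub>0\<close> of the support \<open>S\<close> in steps of length \<open>h\<close> to both sides. Each step
  glues an interval of length \<open>2 * h\<close> along an overlap of length \<open>h\<close>. If the interior of the overlap meets \<open>S\<close>, it has
  positive probability. Otherwise, as \<open>S\<close> is an interval containing \<open>x\<^sub>0\<close>, nothing of \<open>S\<close> lies beyond the
  overlap and the step adds only a null set.\<close>

lemma factorizes_on_UNIV_if_locally: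
  assumes [measurable]: "X \<in> borel_measurable M" "Y \<in> borel_measurable M" "J \<in> sets borel"
    and S: "is_interval S" "S \<in> sets borel" "x\<^sub>0 \<in> S" and null: "rect_prob M X Y (- S) UNIV = 0"
    and pos: "\<And>u v. {u<..<v} \<inter> S \<noteq> {} \<Longrightarrow> rect_prob M X Y {u<..<v} J > 0"
    and h: "h > 0"
    and loc: "\<And>u v. v - u = 2 * h \<Longrightarrow> {u<..<v} \<inter> S \<noteq> {} \<Longrightarrow> factorizes_on M X Y {u..v} J"
  shows "factorizes_on M X Y UNIV J"
proof -
  note [measurable] = S(2)
  have extend: "factorizes_on M X Y (I \<union> K) J"
    if f: "factorizes_on M X Y I J" and [measurable]: "I \<in> sets borel" and K: "K = {u..v}" "v - u = 2 * h"
      and overlap: "{s<..<t} \<subseteq> I" "u \<le> s" "t \<le> v"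
      and off: "{s<..<t} \<inter> S = {} \<Longrightarrow> (K - I) \<inter> S = {}" for I K u v s t
  proof (cases "{s<..<t} \<inter> S = {}")
    case False
    have [measurable]: "K \<in> sets borel" by (simp add: K)
    have "rect_prob M X Y {s<..<t} J \<le> rect_prob M X Y (I \<inter> K) J"
      using overlap by (intro rect_prob_mono) (auto simp: K)
    with pos[OF False] have "rect_prob M X Y (I \<inter> K) J > 0" by linarith
    moreover have "{u<..<v} \<inter> S \<noteq> {}"
    proof -
      obtain x where "x \<in> S" "s < x" "x < t" using False by auto
      with overlap have "u < x" "x < v" by auto
      with \<open>x \<in> S\<close> show ?thesis by auto
    qed
    then have "factorizes_on M X Y K J"
      unfolding K(1) by (rule loc[OF K(2)])
    ultimately show ?thesis
      using f by (intro factorizes_on_Un) auto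
  next
    case True
    have [measurable]: "K \<in> sets borel" by (simp add: K)
    have "rect_prob M X Y (I \<union> K - I) UNIV \<le> rect_prob M X Y (- S) UNIV"
      using off[OF True] by (intro rect_prob_mono) auto
    then have "rect_prob M X Y (I \<union> K - I) UNIV = 0"
      using null rect_prob_nonneg[of X Y "I \<union> K - I" UNIV] by linarith
    then show ?thesis
      by (intro factorizes_on_extend_null[OF assms(1,2) _ _ assms(3) f]) simp_all
  qed
  have mem: "y \<in> S" if "x \<in> S" "x \<le> y" "y \<le> z" "z \<in> S" for x y z
    using S(1) that unfolding is_interval_1 by blast
  have step: "factorizes_on M X Y {a - h..b + h} J"
    if f: "factorizes_on M X Y {a..b} J" and ab: "a + h \<le> x\<^sub>0" "x\<^sub>0 \<le> b - h" for a b
  proof -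
    \<comment> \<open>the overlap with the old interval is \<open>{b - h..b}\<close>\<close>
    have "factorizes_on M X Y ({a..b} \<union> {b - h..b + h}) J"
    proof (rule extend[OF f _ refl, of "b + h" "b - h" "b - h" b])
      assume e: "{b - h<..<b} \<inter> S = {}"
      have "z \<notin> S" if z: "z \<in> {b - h..b + h} - {a..b}" for z
      proof
        assume "z \<in> S"
        have "b < z" using z ab h by simp linarith
        then have "b - h / 2 \<in> S"
          using ab h by (intro mem[OF S(3) _ _ \<open>z \<in> S\<close>]) linarith+
        moreover have "b - h / 2 \<in> {b - h<..<b}" using h by simp
        ultimately show False using e by blast
      qed
      then show "({b - h..b + h} - {a..b}) \<inter> S = {}" by blast
    next
      show "{b - h<..<b} \<subseteq> {a..b}" using ab h by (simp add: subset_eq)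
    qed (use h in simp_all)
    also have "{a..b} \<union> {b - h..b + h} = {a..b + h}"
      using ab h by (simp add: set_eq_iff) linarith
    finally have right: "factorizes_on M X Y {a..b + h} J" .
    \<comment> \<open>likewise on the left, with overlap \<open>{a..a + h}\<close>\<close>
    have "factorizes_on M X Y ({a..b + h} \<union> {a - h..a + h}) J"
    proof (rule extend[OF right _ refl, of "a + h" "a - h" a "a + h"])
      assume e: "{a<..<a + h} \<inter> S = {}"
      have "z \<notin> S" if z: "z \<in> {a - h..a + h} - {a..b + h}" for z
      proof
        assume "z \<in> S"
        have "z < a" using z ab h by simp linarith
        then have "a + h / 2 \<in> S"
          using ab h by (intro mem[OF \<open>z \<in> S\<close> _ _ S(3)]) linarith+
        moreover have "a + h / 2 \<in> {a<..<a + h}" using h by simp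
        ultimately show False using e by blast
      qed
      then show "({a - h..a + h} - {a..b + h}) \<inter> S = {}" by blast
    next
      show "{a<..<a + h} \<subseteq> {a..b + h}" using ab h by (simp add: subset_eq)
    qed (use h in simp_all)
    also have "{a..b + h} \<union> {a - h..a + h} = {a - h..b + h}"
      using ab h by (simp add: set_eq_iff) linarith
    finally show ?thesis .
  qed
  let ?I = "\<lambda>n. {x\<^sub>0 - real (Suc n) * h..x\<^sub>0 + real (Suc n) * h}"
  have "factorizes_on M X Y (?I n) J" for n
  proof (induction n)
    case 0
    have "x\<^sub>0 \<in> {x\<^sub>0 - real (Suc 0) * h<..<x\<^sub>0 + real (Suc 0) * h} \<inter> S"
      using h S(3) by simp
    then show ?case by (intro loc) (simp, blast)
  next
    case (Suc n)
    have "h \<le> real (Suc n) * h" using h by simp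
    then have "factorizes_on M X Y {x\<^sub>0 - real (Suc n) * h - h..x\<^sub>0 + real (Suc n) * h + h} J"
      by (intro step Suc.IH) simp_all
    moreover have "x\<^sub>0 - real (Suc n) * h - h = x\<^sub>0 - real (Suc (Suc n)) * h"
      "x\<^sub>0 + real (Suc n) * h + h = x\<^sub>0 + real (Suc (Suc n)) * h"
      by (simp_all add: algebra_simps)
    ultimately show ?case by (simp only:)
  qed
  moreover have "incseq ?I"
    using h by (intro incseq_SucI) (simp add: distrib_right)
  moreover have "(\<Union>n. ?I n) = UNIV"
  proof (intro equalityI subsetI UNIV_I)
    fix x :: real
    obtain n where n: "\<bar>x - x\<^sub>0\<bar> / h \<le> real n" using real_arch_simple by blast
    have "\<bar>x - x\<^sub>0\<bar> \<le> real n * h" using n h by (simp add: pos_divide_le_eq)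
    also have "\<dots> \<le> real (Suc n) * h" using h by simp
    finally have "x \<in> ?I n" unfolding abs_le_iff atLeastAtMost_iff by linarith
    then show "x \<in> (\<Union>n. ?I n)" by blast
  qed
  moreover have "?I n \<in> sets borel" for n by simp
  ultimately show ?thesis
    using factorizes_on_incseq[OF assms(1,2) _ assms(3), of ?I] by blast
qed

section \<open>Independence and its local consequences\<close>

lemma indep_var_iff_factorizes:
  assumes [measurable]: "X \<in> borel_measurable M" "Y \<in> borel_measurable M"
  shows "indep_var borel X borel Y \<longleftrightarrow> factorizes_on M X Y UNIV UNIV"
proof -
  let ?F = "\<lambda>X. {X -` A \<inter> space M | A. A \<in> sets (borel :: real measure)}"
  have rect: "rect_prob M X Y B C = prob ((X -` B \<inter> space M) \<inter> (Y -` C \<inter> space M))" for B C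
    unfolding rect_prob_def by (rule arg_cong[where f=prob]) auto
  have X_UNIV: "rect_prob M X Y B UNIV = prob (X -` B \<inter> space M)" for B
    unfolding rect_prob_def by (rule arg_cong[where f=prob]) auto
  have Y_UNIV: "rect_prob M X Y UNIV C = prob (Y -` C \<inter> space M)" for C
    unfolding rect_prob_def by (rule arg_cong[where f=prob]) auto
  have "indep_var borel X borel Y \<longleftrightarrow> indep_set (sigma_sets (space M) (?F X)) (sigma_sets (space M) (?F Y))"
    by (simp add: indep_var_eq)
  also have "\<dots> \<longleftrightarrow> indep_set (?F X) (?F Y)"
  proof
    assume "indep_set (sigma_sets (space M) (?F X)) (sigma_sets (space M) (?F Y))"
    then show "indep_set (?F X) (?F Y)"
      unfolding indep_sets2_eq by (blast intro: sigma_sets.Basic)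
  next
    assume "indep_set (?F X) (?F Y)"
    moreover have "Int_stable (?F Z)" for Z :: "'a \<Rightarrow> real"
    proof (safe intro!: Int_stableI)
      fix A B :: "real set" assume "A \<in> sets borel" "B \<in> sets borel"
      then show "\<exists>C. Z -` A \<inter> space M \<inter> (Z -` B \<inter> space M) = Z -` C \<inter> space M \<and> C \<in> sets borel"
        by (intro exI[of _ "A \<inter> B"]) auto
    qed
    ultimately show "indep_set (sigma_sets (space M) (?F X)) (sigma_sets (space M) (?F Y))"
      by (intro indep_set_sigma_sets)
  qed
  also have "\<dots> \<longleftrightarrow> (\<forall>B\<in>sets borel. \<forall>C\<in>sets borel.
      prob ((X -` B \<inter> space M) \<inter> (Y -` C \<inter> space M)) = prob (X -` B \<inter> space M) * prob (Y -` C \<inter> space M))"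
  proof -
    have "?F Z \<subseteq> events" if "Z \<in> borel_measurable M" for Z :: "'a \<Rightarrow> real"
      using measurable_sets[OF that] by blast
    from this[OF assms(1)] this[OF assms(2)] show ?thesis
      by (simp add: indep_sets2_eq setcompr_eq_image)
  qed
  also have "\<dots> \<longleftrightarrow> factorizes_on M X Y UNIV UNIV"
    unfolding factorizes_on_def X_UNIV Y_UNIV by (simp add: rect prob_space)
  finally show ?thesis .
qed

text \<open>\<open>X\<close> and \<open>Y\<close> enter only through their truncations to bounded intervals, which are integrable and again
  independent.\<close>

lemma uncorrelated_on_if_indep:
  assumes ind: "indep_var borel X borel Y"
  shows "uncorrelated_on X Y {a..b} {c..d}"
proof -
  have [measurable]: "X \<in> borel_measurable M" "Y \<in> borel_measurable M"
    using indep_var_rv1[OF ind] indep_var_rv2[OF ind] by auto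
  have prod: "expectation (\<lambda>\<omega>. (F (X \<omega>) * indicator {a..b} (X \<omega>)) * (G (Y \<omega>) * indicator {c..d} (Y \<omega>)))
     = expectation (\<lambda>\<omega>. F (X \<omega>) * indicator {a..b} (X \<omega>)) * expectation (\<lambda>\<omega>. G (Y \<omega>) * indicator {c..d} (Y \<omega>))"
    if F: "F = (\<lambda>x. x) \<or> F = (\<lambda>x. 1)" and G: "G = (\<lambda>x. x) \<or> G = (\<lambda>x. 1)" for F G :: "real \<Rightarrow> real"
  proof (rule indep_var_lebesgue_integral)
    have [measurable]: "F \<in> borel_measurable borel" "G \<in> borel_measurable borel" using F G by auto
    show "indep_var borel (\<lambda>\<omega>. F (X \<omega>) * indicator {a..b} (X \<omega>)) borel (\<lambda>\<omega>. G (Y \<omega>) * indicator {c..d} (Y \<omega>))"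
      using indep_var_compose[OF ind, of "\<lambda>x. F x * indicator {a..b} x" borel "\<lambda>y. G y * indicator {c..d} y" borel]
      by (simp add: comp_def)
    show "integrable M (\<lambda>\<omega>. F (X \<omega>) * indicator {a..b} (X \<omega>))"
      using F by (intro integrable_const_bound[where B="\<bar>a\<bar> + \<bar>b\<bar> + 1"]) (auto simp: indicator_def)
    show "integrable M (\<lambda>\<omega>. G (Y \<omega>) * indicator {c..d} (Y \<omega>))"
      using G by (intro integrable_const_bound[where B="\<bar>c\<bar> + \<bar>d\<bar> + 1"]) (auto simp: indicator_def)
  qed
  from prod[of "\<lambda>x. x" "\<lambda>x. x"] prod[of "\<lambda>x. x" "\<lambda>x. 1"] prod[of "\<lambda>x. 1" "\<lambda>x. x"] prod[of "\<lambda>x. 1" "\<lambda>x. 1"]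
  show ?thesis
    by (simp add: uncorrelated_on_def rect_indicator_def[abs_def] mult_ac)
qed

lemma locally_uncorrelated_if_indep:
  assumes ind: "indep_var borel X borel Y"
  shows "locally_uncorrelated M X Y"
proof -
  have [measurable]: "X \<in> borel_measurable M" "Y \<in> borel_measurable M"
    using indep_var_rv1[OF ind] indep_var_rv2[OF ind] by auto
  have "event_cov M {\<omega> \<in> space M. X \<omega> \<in> {a..b} \<and> Y \<omega> \<in> {c..d}} X Y = 0"
    if "prob {\<omega> \<in> space M. X \<omega> \<in> {a..b} \<and> Y \<omega> \<in> {c..d}} > 0" for a b c d
    using event_cov_rect[OF _ _ _ _ refl that] uncorrelated_on_if_indep[OF ind] by simp
  then show ?thesis
    unfolding locally_uncorrelated_def Let_def by (intro exI[of _ 1]) auto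
qed

end

section \<open>The equivalence under full rectangular support\<close>

lemma measure_pos_if_open_meets_support:
  fixes P :: "'a::topological_space measure"
  assumes "prob_space P" and sets: "sets P = sets borel" and "open G" "G \<inter> measure_support P \<noteq> {}"
  shows "measure P G > 0"
proof (rule ccontr)
  interpret prob_space P by fact
  assume "\<not> measure P G > 0"
  then have "measure P G = 0" using measure_nonneg[of P G] by linarith
  moreover have "G \<in> sets P" using \<open>open G\<close> sets by auto
  moreover have "space P = UNIV" using sets_eq_imp_space_eq[OF sets] by simp
  ultimately have "emeasure P (- G) = 1"
    using prob_compl[of G] by (simp add: emeasure_eq_measure Compl_eq_Diff_UNIV)
  then have "measure_support P \<subseteq> - G"
    using \<open>open G\<close> by (auto simp: measure_support_def)
  then show False using assms(4) by auto
qed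

theorem theorem7:
  fixes M :: "'a measure" and X Y :: "'a \<Rightarrow> real"
  assumes "prob_space M"
    and "X \<in> borel_measurable M" and "Y \<in> borel_measurable M"
    and "is_interval (measure_support (distr M borel X))"
    and "is_interval (measure_support (distr M borel Y))"
    and "measure_support (distr M borel (\<lambda>\<omega>. (X \<omega>, Y \<omega>))) =
           measure_support (distr M borel X) \<times> measure_support (distr M borel Y)"
  shows "prob_space.indep_var M borel X borel Y \<longleftrightarrow> locally_uncorrelated M X Y"
proof -
  interpret prob_space M by fact
  note [measurable] = assms(2,3)
  define S T where "S = measure_support (distr M borel X)" and "T = measure_support (distr M borel Y)"
  have marginal: "closed (measure_support (distr M borel Z)) \<and> measure_support (distr M borel Z) \<noteq> {}
      \<and> prob {\<omega> \<in> space M. Z \<omega> \<notin> measure_support (distr M borel Z)} = 0"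
    if [measurable]: "Z \<in> borel_measurable M" for Z :: "'a \<Rightarrow> real"
  proof -
    let ?R = "measure_support (distr M borel Z)"
    have P: "prob_space (distr M borel Z)" by (rule prob_space_distr) fact
    note supp = is_least_measure_support(1,2)[OF P]
    have cl: "closed ?R" using supp(1) by simp
    then have [measurable]: "?R \<in> sets borel" by simp
    have "emeasure (distr M borel Z) ?R = 1" using supp(2) by simp
    then have one: "prob (Z -` ?R \<inter> space M) = 1"
      by (simp add: emeasure_distr emeasure_eq_measure)
    then have "?R \<noteq> {}" by (metis measure_empty vimage_empty inf_bot_left zero_neq_one)
    moreover have "{\<omega> \<in> space M. Z \<omega> \<notin> ?R} = space M - (Z -` ?R \<inter> space M)" by auto
    then have "prob {\<omega> \<in> space M. Z \<omega> \<notin> ?R} = 0"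
      using one by (simp add: prob_compl)
    ultimately show ?thesis using cl by simp
  qed
  note X = marginal[OF assms(2), folded S_def] and Y = marginal[OF assms(3), folded T_def]
  obtain x\<^sub>0 y\<^sub>0 where x0: "x\<^sub>0 \<in> S" and y0: "y\<^sub>0 \<in> T" using X Y by blast
  have [measurable]: "S \<in> sets borel" "T \<in> sets borel" using X Y by auto
  \<comment> \<open>the only place where the product form of the joint support enters\<close>
  have pos: "rect_prob M X Y G H > 0"
    if "open G" "open H" "G \<inter> S \<noteq> {}" "H \<inter> T \<noteq> {}" for G H
  proof -
    let ?P = "distr M borel (\<lambda>\<omega>. (X \<omega>, Y \<omega>))"
    have XY: "(\<lambda>\<omega>. (X \<omega>, Y \<omega>)) \<in> measurable M borel"
      unfolding borel_prod[symmetric] by measurable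
    have GH: "G \<times> H \<in> sets borel"
      using that by (intro borel_open open_Times)
    have "measure ?P (G \<times> H) > 0"
    proof (rule measure_pos_if_open_meets_support)
      show "prob_space ?P" by (rule prob_space_distr) (rule XY)
      show "(G \<times> H) \<inter> measure_support ?P \<noteq> {}"
        using that assms(6) by (auto simp: S_def T_def)
    qed (use that in \<open>auto intro: open_Times\<close>)
    also have "measure ?P (G \<times> H) = rect_prob M X Y G H"
      unfolding rect_prob_def using GH
      by (subst measure_distr[OF XY]) (auto intro!: arg_cong[where f=prob])
    finally show ?thesis .
  qed
  have "factorizes_on M X Y UNIV UNIV" if lu: "locally_uncorrelated M X Y"
  proof -
    obtain \<epsilon> where "\<epsilon> > 0" and unc: "\<And>a b c d. b - a \<le> \<epsilon> \<Longrightarrow> d - c \<le> \<epsilon> \<Longrightarrow> uncorrelated_on X Y {a..b} {c..d}"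
      using uncorrelated_on_small_intervals[OF assms(2,3) lu] by blast
    define h where "h = \<epsilon> / 2"
    have "h > 0" using \<open>\<epsilon> > 0\<close> by (simp add: h_def)
    \<comment> \<open>on a thin horizontal strip meeting the support, independence spreads in the \<open>X\<close> direction\<close>
    have strip: "factorizes_on M X Y UNIV {c..d}" if "d - c = 2 * h" "{c<..<d} \<inter> T \<noteq> {}" for c d
    proof (rule factorizes_on_UNIV_if_locally[where S=S and h=h])
      show "rect_prob M X Y (- S) UNIV = 0" using X by (simp add: rect_prob_def)
      show "rect_prob M X Y {u<..<v} {c..d} > 0" if "{u<..<v} \<inter> S \<noteq> {}" for u v
      proof -
        have "rect_prob M X Y {u<..<v} {c<..<d} > 0"
          using that \<open>{c<..<d} \<inter> T \<noteq> {}\<close> by (intro pos) auto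
        also have "\<dots> \<le> rect_prob M X Y {u<..<v} {c..d}"
          by (intro rect_prob_mono) auto
        finally show ?thesis .
      qed
      show "factorizes_on M X Y {u..v} {c..d}" if "v - u = 2 * h" for u v
        using that \<open>d - c = 2 * h\<close> by (intro factorizes_on_if_uncorrelated unc) (auto simp: h_def)
    qed (use assms(4) x0 \<open>h > 0\<close> in \<open>auto simp: S_def[symmetric]\<close>)
    \<comment> \<open>the full-width strips are then glued in the \<open>Y\<close> direction\<close>
    have "factorizes_on M Y X UNIV UNIV"
    proof (rule factorizes_on_UNIV_if_locally[where S=T and h=h])
      show "rect_prob M Y X (- T) UNIV = 0" using Y by (simp add: rect_prob_def)
      show "rect_prob M Y X {u<..<v} UNIV > 0" if "{u<..<v} \<inter> T \<noteq> {}" for u v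
        unfolding rect_prob_swap[of Y X] using that x0 by (intro pos) auto
      show "factorizes_on M Y X {u..v} UNIV" if "v - u = 2 * h" "{u<..<v} \<inter> T \<noteq> {}" for u v
        unfolding factorizes_on_swap[of Y X] using that by (rule strip)
    qed (use assms(5) y0 \<open>h > 0\<close> in \<open>auto simp: T_def[symmetric]\<close>)
    then show ?thesis by (simp add: factorizes_on_swap[of Y X])
  qed
  then show ?thesis
    using locally_uncorrelated_if_indep indep_var_iff_factorizes[OF assms(2,3)] by blast
qed

end
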